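(* Let $G^\sigma$ be an oriented hypergraph. Then the following are equivalent: (1) $G^\sigma$ is incidence balanced; (2) each cycle of $G^\sigma$ has positive incidence sign; (3) for any $a,b\in V(G)\cup E(G)$, all paths of $G^\sigma$ from $a$ to $b$ have the same incidence sign; (4) the signed incidence graph $\mathrm{I}G^\sigma$ is balanced; (5) $G^\sigma$ is switching equivalent to $G^+$.
   Context: A hypergraph $G$ has a finite vertex set $V(G)$ and edge set $E(G)$, each edge being a subset of $V(G)$. An incidence is a pair $(e,v)$ with $v\in e\in E(G)$. An oriented hypergraph $G^\sigma$ is $G$ together with a map $\sigma$ from the set of incidences to $\{-1,1\}$; $G^+$ denotes the oriented hypergraph on $G$ with $\sigma\equiv 1$. $G^\sigma$ is incidence balanced if there is a bipartition $\{X,Y\}$ of $V(G)$ ($X\cup Y=V(G)$, $X\cap Y=\emptyset$, one part possibly empty) such that for every edge $e$, either $\sigma(e,v)=1$ for all $v\in e\cap X$ and $\sigma(e,v)=-1$ for all $v\in e\cap Y$, or $\sigma(e,v)=-1$ for all $v\in e\cap X$ and $\sigma(e,v)=1$ for all $v\in e\cap Y$. A walk is a sequence $a_0,i_1,a_1,\dots,i_t,a_t$ where $a_0,\dots,a_t$ alternate between vertices and edges and $i_j$ is the incidence consisting of $a_{j-1}$ and $a_j$. It is a path if no vertex, edge or incidence is repeated, and a cycle if no vertex, edge or incidence is repeated except $a_0=a_t$. Its incidence sign is $\prod_{j=1}^t\sigma(i_j)$. The signed incidence graph $\mathrm{I}G^\sigma$ is the bipartite graph with vertex set $V(G)\cup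 E(G)$, whose edges are the incidences $(e,v)$ (joining $e$ and $v$), with sign $\sigma(e,v)$; a signed graph is balanced if the product of the edge signs along every cycle is positive. A vertex switching at $v$ replaces $\sigma(e,v)$ by $-\sigma(e,v)$ for all edges $e\ni v$; an edge switching at $e$ replaces $\sigma(e,v)$ by $-\sigma(e,v)$ for all $v\in e$; two oriented hypergraphs on $G$ are switching equivalent if one is obtained from the other by a finite sequence of vertex and/or edge switchings. *)

theory Defs
  imports Main "HOL-Library.FuncSet"
begin

section \<open>Oriented hypergraphs\<close>

record 'v hypergraph =
  verts :: "'v set"
  hedges :: "'v set set"

text \<open>Empty edges, singleton edges and isolated vertices are allowed. There are no multiple edges:
  an edge is identified with the set of its vertices.\<close>

definition hypergraph :: "'v hypergraph \<Rightarrow> bool" where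
  "hypergraph G \<longleftrightarrow> finite (verts G) \<and> (\<forall>e\<in>hedges G. e \<subseteq> verts G)"

type_synonym 'v incidence = "'v set \<times> 'v"

definition incidences :: "'v hypergraph \<Rightarrow> 'v incidence set" where
  "incidences G = {(e, v). e \<in> hedges G \<and> v \<in> e}"

text \<open>Orientations are extensional functions on the set of incidences, so that two orientations of
  the same hypergraph are equal iff they agree on all incidences.\<close>

definition orientation :: "'v hypergraph \<Rightarrow> ('v incidence \<Rightarrow> int) \<Rightarrow> bool" where
  "orientation G \<sigma> \<longleftrightarrow> \<sigma> \<in> incidences G \<rightarrow>\<^sub>E {-1, 1}"

definition positive_orientation :: "'v hypergraph \<Rightarrow> 'v incidence \<Rightarrow> int" where
  "positive_orientation G = (\<lambda>i\<in>incidences G. 1)"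

definition incidence_balanced :: "'v hypergraph \<Rightarrow> ('v incidence \<Rightarrow> int) \<Rightarrow> bool" where
  "incidence_balanced G \<sigma> \<longleftrightarrow>
     (\<exists>X Y. X \<union> Y = verts G \<and> X \<inter> Y = {} \<and>
        (\<forall>e\<in>hedges G.
           ((\<forall>v\<in>e \<inter> X. \<sigma> (e, v) = 1) \<and> (\<forall>v\<in>e \<inter> Y. \<sigma> (e, v) = -1)) \<or>
           ((\<forall>v\<in>e \<inter> X. \<sigma> (e, v) = -1) \<and> (\<forall>v\<in>e \<inter> Y. \<sigma> (e, v) = 1))))"


section \<open>Walks, paths and cycles\<close>

text \<open>The set \<open>V(G) \<union> E(G)\<close>, formed as a disjoint union.\<close>

definition elements :: "'v hypergraph \<Rightarrow> ('v + 'v set) set" where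
  "elements G = verts G <+> hedges G"

text \<open>The walk \<open>a\<^sub>0, i\<^sub>1, a\<^sub>1, \<dots>, i\<^sub>t, a\<^sub>t\<close> is given by the lists \<open>xs = [a\<^sub>0, \<dots>, a\<^sub>t]\<close> and
  \<open>ps = [i\<^sub>1, \<dots>, i\<^sub>t]\<close>. The last condition makes vertices and edges alternate in \<open>xs\<close>.\<close>

definition walk :: "'v hypergraph \<Rightarrow> ('v + 'v set) list \<Rightarrow> 'v incidence list \<Rightarrow> bool" where
  "walk G xs ps \<longleftrightarrow>
     length xs = Suc (length ps) \<and> set xs \<subseteq> elements G \<and> set ps \<subseteq> incidences G \<and>
     (\<forall>j<length ps. \<exists>e v. ps ! j = (e, v) \<and> {xs ! j, xs ! Suc j} = {Inr e, Inl v})"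

definition path :: "'v hypergraph \<Rightarrow> ('v + 'v set) list \<Rightarrow> 'v incidence list \<Rightarrow> bool" where
  "path G xs ps \<longleftrightarrow> walk G xs ps \<and> distinct xs \<and> distinct ps"

definition path_between ::
    "'v hypergraph \<Rightarrow> 'v + 'v set \<Rightarrow> 'v + 'v set \<Rightarrow> ('v + 'v set) list \<Rightarrow> 'v incidence list \<Rightarrow> bool" where
  "path_between G a b xs ps \<longleftrightarrow> path G xs ps \<and> hd xs = a \<and> last xs = b"

text \<open>With \<open>hd xs = last xs\<close>, distinctness of \<open>tl xs\<close> says that there is no repetition among
  \<open>a\<^sub>0, \<dots>, a\<^sub>t\<close> other than \<open>a\<^sub>0 = a\<^sub>t\<close>. Distinctness of \<open>ps\<close> excludes going back along the same
  incidence.\<close>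

definition cycle :: "'v hypergraph \<Rightarrow> ('v + 'v set) list \<Rightarrow> 'v incidence list \<Rightarrow> bool" where
  "cycle G xs ps \<longleftrightarrow>
     walk G xs ps \<and> ps \<noteq> [] \<and> hd xs = last xs \<and> distinct (tl xs) \<and> distinct ps"

definition incidence_sign :: "('v incidence \<Rightarrow> int) \<Rightarrow> 'v incidence list \<Rightarrow> int" where
  "incidence_sign \<sigma> ps = prod_list (map \<sigma> ps)"


section \<open>Signed graphs and the signed incidence graph\<close>

text \<open>The edges of a signed graph are abstract objects with a set of one (loop) or two end points.\<close>

record ('n, 'l) signed_graph =
  nodes :: "'n set"
  links :: "'l set"
  ends :: "'l \<Rightarrow> 'n set"
  link_sign :: "'l \<Rightarrow> int"

definition signed_graph :: "('n, 'l) signed_graph \<Rightarrow> bool" where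
  "signed_graph S \<longleftrightarrow>
     finite (nodes S) \<and> finite (links S) \<and>
     (\<forall>l\<in>links S. ends S l \<subseteq> nodes S \<and> card (ends S l) \<in> {1, 2} \<and> link_sign S l \<in> {-1, 1})"

definition graph_cycle :: "('n, 'l) signed_graph \<Rightarrow> 'n list \<Rightarrow> 'l list \<Rightarrow> bool" where
  "graph_cycle S ns ls \<longleftrightarrow>
     length ns = Suc (length ls) \<and> set ns \<subseteq> nodes S \<and> set ls \<subseteq> links S \<and>
     (\<forall>j<length ls. ends S (ls ! j) = {ns ! j, ns ! Suc j}) \<and>
     ls \<noteq> [] \<and> hd ns = last ns \<and> distinct (tl ns) \<and> distinct ls"

definition balanced :: "('n, 'l) signed_graph \<Rightarrow> bool" where
  "balanced S \<longleftrightarrow> (\<forall>ns ls. graph_cycle S ns ls \<longrightarrow> prod_list (map (link_sign S) ls) > 0)"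

definition signed_incidence_graph ::
    "'v hypergraph \<Rightarrow> ('v incidence \<Rightarrow> int) \<Rightarrow> ('v + 'v set, 'v incidence) signed_graph" where
  "signed_incidence_graph G \<sigma> =
     \<lparr>nodes = elements G, links = incidences G, ends = (\<lambda>(e, v). {Inr e, Inl v}), link_sign = \<sigma>\<rparr>"

lemma finite_incidences:
  assumes "hypergraph G"
  shows "finite (hedges G)" and "finite (incidences G)"
proof -
  show "finite (hedges G)"
    using assms by (auto simp: hypergraph_def intro: finite_subset[of _ "Pow (verts G)"])
  moreover have "incidences G \<subseteq> hedges G \<times> verts G"
    using assms by (auto simp: hypergraph_def incidences_def)
  ultimately show "finite (incidences G)"
    using assms by (auto simp: hypergraph_def intro: finite_subset)
qed

lemma signed_graph_signed_incidence_graph: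
  assumes "hypergraph G" "orientation G \<sigma>"
  shows "signed_graph (signed_incidence_graph G \<sigma>)"
  using assms finite_incidences[OF assms(1)]
  unfolding signed_graph_def signed_incidence_graph_def orientation_def elements_def
  by (fastforce simp: hypergraph_def incidences_def PiE_iff)


section \<open>Switching\<close>

definition switch_vertex ::
    "'v hypergraph \<Rightarrow> 'v \<Rightarrow> ('v incidence \<Rightarrow> int) \<Rightarrow> 'v incidence \<Rightarrow> int" where
  "switch_vertex G w \<sigma> = (\<lambda>(e, v)\<in>incidences G. if v = w then - \<sigma> (e, v) else \<sigma> (e, v))"

definition switch_edge ::
    "'v hypergraph \<Rightarrow> 'v set \<Rightarrow> ('v incidence \<Rightarrow> int) \<Rightarrow> 'v incidence \<Rightarrow> int" where
  "switch_edge G f \<sigma> = (\<lambda>(e, v)\<in>incidences G. if e = f then - \<sigma> (e, v) else \<sigma> (e, v))"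

definition switching_step ::
    "'v hypergraph \<Rightarrow> ('v incidence \<Rightarrow> int) \<Rightarrow> ('v incidence \<Rightarrow> int) \<Rightarrow> bool" where
  "switching_step G \<sigma> \<tau> \<longleftrightarrow>
     (\<exists>w\<in>verts G. \<tau> = switch_vertex G w \<sigma>) \<or> (\<exists>f\<in>hedges G. \<tau> = switch_edge G f \<sigma>)"

text \<open>On orientations this relation is symmetric, because each switching is an involution.\<close>

definition switching_equivalent ::
    "'v hypergraph \<Rightarrow> ('v incidence \<Rightarrow> int) \<Rightarrow> ('v incidence \<Rightarrow> int) \<Rightarrow> bool" where
  "switching_equivalent G = (switching_step G)\<^sup>*\<^sup>*"

end

theory Submission
  imports Defs
begin

text \<open>Each of the five conditions is equivalent to the existence of a potential: a map \<open>\<phi>\<close> from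
  \<open>V(G) \<union> E(G)\<close> to \<open>{-1, 1}\<close> with \<open>\<sigma> (e, v) = \<phi> e * \<phi> v\<close> for every incidence. The level sets of \<open>\<phi>\<close>
  on the vertices form the required bipartition; along a walk the signs telescope; and switching at
  \<open>x\<close> amounts to negating \<open>\<phi> x\<close>. To construct \<open>\<phi>\<close> when all cycles are positive, insert the incidences
  one at a time: if \<open>e\<close> and \<open>v\<close> are already joined by a path, this path closes up to a positive cycle,
  so \<open>\<phi>\<close> is already correct on \<open>(e, v)\<close>; otherwise \<open>\<phi>\<close> may be negated on the component of \<open>v\<close>.\<close>

section \<open>Potentials and elementary facts on signs and elements\<close>

definition incidence_ends :: "'v incidence \<Rightarrow> ('v + 'v set) set" where
  "incidence_ends i = {Inr (fst i), Inl (snd i)}"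

text \<open>The set \<open>I\<close> is a parameter so that a potential can be built up one
  incidence at a time. Values are constrained on the whole type, so squares cancel without
  membership conditions.\<close>

definition potential ::
    "'v incidence set \<Rightarrow> ('v incidence \<Rightarrow> int) \<Rightarrow> ('v + 'v set \<Rightarrow> int) \<Rightarrow> bool" where
  "potential I \<sigma> \<phi> \<longleftrightarrow>
     (\<forall>x. \<phi> x \<in> {-1, 1}) \<and> (\<forall>e v. (e, v) \<in> I \<longrightarrow> \<sigma> (e, v) = \<phi> (Inr e) * \<phi> (Inl v))"

lemma potential_square:
  assumes "potential I \<sigma> \<phi>"
  shows "\<phi> x * \<phi> x = 1"
proof -
  have "\<phi> x = -1 \<or> \<phi> x = 1"
    using assms by (auto simp: potential_def)
  then show ?thesis by auto
qed

lemma potential_incidence_ends: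
  assumes "potential I \<sigma> \<phi>" "i \<in> I" "incidence_ends i = {a, b}"
  shows "\<sigma> i = \<phi> a * \<phi> b"
  using assms by (cases i) (auto simp: potential_def incidence_ends_def doubleton_eq_iff)

lemma orientation_sign:
  assumes "orientation G \<sigma>" "i \<in> incidences G"
  shows "\<sigma> i = -1 \<or> \<sigma> i = 1"
  using assms by (auto simp: orientation_def PiE_iff)

lemma incidence_in_elements:
  assumes "hypergraph G" "(e, v) \<in> incidences G"
  shows "Inr e \<in> elements G" "Inl v \<in> elements G"
  using assms by (auto simp: hypergraph_def incidences_def elements_def)

lemma finite_elements:
  assumes "hypergraph G"
  shows "finite (elements G)"
  using assms finite_incidences(1)[OF assms] by (simp add: elements_def hypergraph_def)


section \<open>Walks\<close>

text \<open>Expresses the link condition through end sets, which ignore the direction of travel and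
  match the form used in \<open>graph_cycle\<close>.\<close>

lemma walk_iff:
  "walk G xs ps \<longleftrightarrow>
     length xs = Suc (length ps) \<and> set xs \<subseteq> elements G \<and> set ps \<subseteq> incidences G \<and>
     (\<forall>j<length ps. incidence_ends (ps ! j) = {xs ! j, xs ! Suc j})"
proof -
  have "(\<exists>e v. i = (e, v) \<and> {a, b} = {Inr e, Inl v}) \<longleftrightarrow> incidence_ends i = {a, b}"
    for i :: "'a incidence" and a b
    by (cases i) (auto simp: incidence_ends_def)
  then show ?thesis by (simp add: walk_def)
qed

lemma walk_Nil: "walk G xs [] \<longleftrightarrow> (\<exists>a\<in>elements G. xs = [a])"
  by (auto simp: walk_iff length_Suc_conv)

lemma walk_Cons:
  "walk G (a # xs) (i # ps) \<longleftrightarrow>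
     a \<in> elements G \<and> i \<in> incidences G \<and> incidence_ends i = {a, hd xs} \<and> walk G xs ps"
proof (cases xs)
  case Nil
  \<comment> \<open>Both sides fail by the length condition, so the unspecified value
    \<open>hd []\<close> does not matter.\<close>
  then show ?thesis by (simp add: walk_iff)
next
  case (Cons b ys)
  then show ?thesis
    by (auto simp: walk_iff All_less_Suc2)
qed

lemma walk_induct [consumes 1, case_names Nil Cons]:
  assumes "walk G xs ps"
    and "\<And>a. a \<in> elements G \<Longrightarrow> P [a] []"
    and "\<And>a xs i ps. \<lbrakk>a \<in> elements G; i \<in> incidences G; incidence_ends i = {a, hd xs};
           walk G xs ps; xs \<noteq> []; P xs ps\<rbrakk> \<Longrightarrow> P (a # xs) (i # ps)"
  shows "P xs ps"
  using assms(1)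
proof (induction ps arbitrary: xs)
  case Nil
  then show ?case using assms(2) by (auto simp: walk_Nil)
next
  case (Cons i ps)
  then obtain a ys where xs: "xs = a # ys"
    by (cases xs) (auto simp: walk_def)
  with Cons.prems have w: "a \<in> elements G" "i \<in> incidences G" "incidence_ends i = {a, hd ys}"
      "walk G ys ps"
    by (simp_all add: walk_Cons)
  moreover from \<open>walk G ys ps\<close> have "ys \<noteq> []" by (auto simp: walk_def)
  ultimately show ?case using assms(3) Cons.IH xs by blast
qed

text \<open>Used contrapositively: an incidence with an end off the walk has not been
  traversed.\<close>

lemma walk_incidence_ends_subset:
  assumes "walk G xs ps" "i \<in> set ps"
  shows "incidence_ends i \<subseteq> set xs"
  using assms
  by (induction rule: walk_induct) (auto dest: hd_in_set)

text \<open>Each interior value of \<open>\<phi>\<close> occurs in two consecutive factors and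
  cancels. Only the traversed incidences must lie in \<open>I\<close>, so a partially built
  potential suffices.\<close>

lemma walk_sign_potential:
  assumes "walk G xs ps" "potential I \<sigma> \<phi>" "set ps \<subseteq> I"
  shows "incidence_sign \<sigma> ps = \<phi> (hd xs) * \<phi> (last xs)"
  using assms
proof (induction rule: walk_induct)
  case (Nil a)
  then show ?case by (simp add: incidence_sign_def potential_square)
next
  case (Cons a xs i ps)
  have "incidence_sign \<sigma> (i # ps) = (\<phi> a * \<phi> (hd xs)) * (\<phi> (hd xs) * \<phi> (last xs))"
    using Cons potential_incidence_ends[OF Cons.prems(1) _ Cons.hyps(3)]
    by (simp add: incidence_sign_def)
  also have "\<dots> = \<phi> a * (\<phi> (hd xs) * \<phi> (hd xs)) * \<phi> (last xs)" by (simp add: ac_simps)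
  finally show ?case using Cons by (simp add: potential_square)
qed


section \<open>Paths and cycles\<close>

text \<open>Drop everything before \<open>c\<close>; distinctness passes to the remaining
  tail.\<close>

lemma path_between_suffix:
  assumes "walk G xs ps" "distinct xs" "distinct ps" "c \<in> set xs"
  obtains ys qs where "path_between G c (last xs) ys qs" "set qs \<subseteq> set ps"
proof -
  have "\<exists>ys qs. path_between G c (last xs) ys qs \<and> set qs \<subseteq> set ps"
    using assms
  proof (induction rule: walk_induct)
    case (Nil a)
    then have "path_between G c (last [a]) [a] []"
      by (simp add: path_between_def path_def walk_Nil)
    then show ?case by auto
  next
    case (Cons a xs i ps)
    show ?case
    proof (cases "c = a")
      case True
      with Cons have "path_between G c (last (a # xs)) (a # xs) (i # ps)"
        by (simp add: path_between_def path_def walk_Cons)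
      then show ?thesis by blast
    next
      case False
      with Cons obtain ys qs where "path_between G c (last xs) ys qs" "set qs \<subseteq> set ps"
        by auto
      with Cons show ?thesis by (auto intro!: exI[of _ ys] exI[of _ qs])
    qed
  qed
  with that show ?thesis by blast
qed

text \<open>If the new start \<open>c\<close> already lies on the path, cut the path at
  \<open>c\<close>; otherwise prepend \<open>i\<close>, which is fresh because its end
  \<open>c\<close> is off the path.\<close>

lemma path_between_extend:
  assumes p: "path_between G a b xs ps"
    and i: "i \<in> incidences G" "incidence_ends i = {c, a}" and c: "c \<in> elements G"
  obtains ys qs where "path_between G c b ys qs" "set qs \<subseteq> insert i (set ps)"
proof (cases "c \<in> set xs")
  case True
  from p have "walk G xs ps" "distinct xs" "distinct ps" "last xs = b"
    by (auto simp: path_between_def path_def)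
  with True obtain ys qs where "path_between G c b ys qs" "set qs \<subseteq> set ps"
    by (metis path_between_suffix)
  with that[of ys qs] show ?thesis by blast
next
  case False
  from p have "walk G xs ps" by (simp add: path_between_def path_def)
  from walk_incidence_ends_subset[OF this] False i have "i \<notin> set ps" by blast
  moreover from \<open>walk G xs ps\<close> have "xs \<noteq> []" by (auto simp: walk_def)
  ultimately have "path_between G c b (c # xs) (i # ps)"
    using p i c False by (auto simp: path_between_def path_def walk_Cons)
  with that show ?thesis by auto
qed

text \<open>Freshness of \<open>i\<close> rules out going back and forth along a single
  incidence.\<close>

lemma cycle_of_path:
  assumes p: "path_between G a b xs ps"
    and i: "i \<in> incidences G" "incidence_ends i = {b, a}" "i \<notin> set ps" and b: "b \<in> elements G"
  shows "cycle G (b # xs) (i # ps)"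
proof -
  from p have "xs \<noteq> []" by (auto simp: path_between_def path_def walk_def)
  then show ?thesis
    using assms by (simp add: cycle_def path_between_def path_def walk_Cons)
qed

text \<open>The first incidence of the cycle, reversed, and the rest of the cycle are two paths with
  the same ends. Their signs agree, so the sign of the cycle is a square.\<close>

lemma cycle_positive_if_path_signs_agree:
  assumes "orientation G \<sigma>"
    and paths: "\<And>a b xs ps ys qs. \<lbrakk>a \<in> elements G; b \<in> elements G; path_between G a b xs ps;
                  path_between G a b ys qs\<rbrakk> \<Longrightarrow> incidence_sign \<sigma> ps = incidence_sign \<sigma> qs"
    and c: "cycle G xs ps"
  shows "incidence_sign \<sigma> ps > 0"
proof -
  from c obtain i qs a ys where xs: "xs = a # ys" and ps: "ps = i # qs"
    by (cases xs; cases ps) (auto simp: cycle_def walk_def)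
  from c have w: "a \<in> elements G" "i \<in> incidences G" "incidence_ends i = {a, hd ys}" "walk G ys qs"
    and ne: "ys \<noteq> []"
    unfolding xs ps by (auto simp: cycle_def walk_Cons) (auto simp: walk_def)
  from ne w(4) have hd: "hd ys \<in> elements G" by (cases ys) (auto simp: walk_def)
  \<comment> \<open>An incidence joins an edge to a vertex, so it is never a loop.\<close>
  have "a \<noteq> hd ys"
  proof
    assume "a = hd ys"
    with w(3) have "Inr (fst i) = a" "Inl (snd i) = a" by (auto simp: incidence_ends_def)
    then show False by (cases a) auto
  qed
  with w hd have "path_between G (hd ys) a [hd ys, a] [i]"
    by (auto simp: path_between_def path_def walk_Cons walk_Nil insert_commute)
  moreover have "path_between G (hd ys) a ys qs"
    using c ne w(4) unfolding xs ps by (simp add: path_between_def path_def cycle_def)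
  ultimately have "incidence_sign \<sigma> qs = \<sigma> i"
    using paths[OF hd w(1)] by (fastforce simp: incidence_sign_def)
  then show ?thesis
    using orientation_sign[OF assms(1) w(2)] unfolding ps by (auto simp: incidence_sign_def)
qed

section \<open>Cycles of the signed incidence graph\<close>

lemma graph_cycle_signed_incidence_graph:
  "graph_cycle (signed_incidence_graph G \<sigma>) xs ps \<longleftrightarrow> cycle G xs ps"
  by (auto simp: graph_cycle_def cycle_def walk_iff signed_incidence_graph_def incidence_ends_def
      case_prod_unfold)

lemma balanced_signed_incidence_graph_iff:
  "balanced (signed_incidence_graph G \<sigma>) \<longleftrightarrow>
     (\<forall>xs ps. cycle G xs ps \<longrightarrow> incidence_sign \<sigma> ps > 0)"
  by (simp add: balanced_def graph_cycle_signed_incidence_graph incidence_sign_def)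
     (simp add: signed_incidence_graph_def)


section \<open>Existence of a potential\<close>

lemma potential_insert:
  assumes G: "hypergraph G" and \<sigma>: "orientation G \<sigma>"
    and cyc: "\<And>xs ps. cycle G xs ps \<Longrightarrow> incidence_sign \<sigma> ps > 0"
    and I: "insert (e, v) I \<subseteq> incidences G" "(e, v) \<notin> I" and \<phi>: "potential I \<sigma> \<phi>"
  shows "\<exists>\<psi>. potential (insert (e, v) I) \<sigma> \<psi>"
proof -
  have ev: "(e, v) \<in> incidences G" using I by simp
  note el = incidence_in_elements[OF G ev]
  have phi_sign: "\<phi> x = -1 \<or> \<phi> x = 1" for x using \<phi> by (auto simp: potential_def)
  \<comment> \<open>The component of \<open>v\<close> in the graph formed by the incidences in
    \<open>I\<close> alone.\<close>
  define C where "C = {a. \<exists>xs ps. path_between G a (Inl v) xs ps \<and> set ps \<subseteq> I}"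
  have "path_between G (Inl v) (Inl v) [Inl v] []"
    using el by (simp add: path_between_def path_def walk_Nil)
  then have v: "Inl v \<in> C"
    unfolding C_def by fastforce
  have step: "c \<in> C"
    if i: "i \<in> I" "incidence_ends i = {c, a}" and a: "a \<in> C" for i a c
  proof -
    have "i \<in> incidences G" "c \<in> elements G"
      using i I(1) incidence_in_elements[OF G, of "fst i" "snd i"]
      by (auto simp: incidence_ends_def doubleton_eq_iff)
    moreover from a obtain xs ps where "path_between G a (Inl v) xs ps" "set ps \<subseteq> I"
      by (auto simp: C_def)
    ultimately obtain ys qs where "path_between G c (Inl v) ys qs" "set qs \<subseteq> insert i (set ps)"
      using i(2) by (metis path_between_extend)
    with \<open>set ps \<subseteq> I\<close> i(1) show ?thesis unfolding C_def by blast
  qed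
  \<comment> \<open>No incidence of \<open>I\<close> leaves \<open>C\<close>: its ends are both
    inside or both outside.\<close>
  have closed: "Inr f \<in> C \<longleftrightarrow> Inl w \<in> C" if "(f, w) \<in> I" for f w
    using step[OF that, of "Inr f" "Inl w"] step[OF that, of "Inl w" "Inr f"]
    by (auto simp: incidence_ends_def)
  show ?thesis
  proof (cases "Inr e \<in> C")
    case True
    then obtain xs ps where p: "path_between G (Inr e) (Inl v) xs ps" "set ps \<subseteq> I"
      by (auto simp: C_def)
    \<comment> \<open>The path stays in \<open>I\<close>, which does not contain
      \<open>(e, v)\<close>, so closing it up repeats no incidence.\<close>
    have "incidence_sign \<sigma> ps = \<phi> (Inr e) * \<phi> (Inl v)"
      using p walk_sign_potential[OF _ \<phi> p(2)] by (auto simp: path_between_def path_def)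
    moreover have "incidence_sign \<sigma> ((e, v) # ps) > 0"
      using cyc[OF cycle_of_path[OF p(1) ev _ _ el(2)]] p(2) I(2) by (auto simp: incidence_ends_def)
    ultimately have "\<sigma> (e, v) = \<phi> (Inr e) * \<phi> (Inl v)"
      using orientation_sign[OF \<sigma> ev] phi_sign[of "Inr e"] phi_sign[of "Inl v"]
      by (auto simp: incidence_sign_def)
    with \<phi> have "potential (insert (e, v) I) \<sigma> \<phi>" by (auto simp: potential_def)
    then show ?thesis by blast
  next
    case False
    \<comment> \<open>The factor on \<open>C\<close> is 1 or -1, chosen to correct the sign at
      \<open>(e, v)\<close>: \<open>Inl v\<close> lies in \<open>C\<close> and \<open>Inr e\<close>
      does not. On an incidence of \<open>I\<close> it enters squared or not at all.\<close>
    define \<psi> where "\<psi> = (\<lambda>x. if x \<in> C then \<sigma> (e, v) * \<phi> (Inr e) * \<phi> (Inl v) * \<phi> x else \<phi> x)"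
    have s: "\<sigma> (e, v) = -1 \<or> \<sigma> (e, v) = 1" by (rule orientation_sign[OF \<sigma> ev])
    have "\<psi> x \<in> {-1, 1}" for x
      using s phi_sign[of x] phi_sign[of "Inr e"] phi_sign[of "Inl v"] by (auto simp: \<psi>_def)
    moreover have "\<sigma> (e, v) = \<psi> (Inr e) * \<psi> (Inl v)"
      using False v phi_sign[of "Inr e"] phi_sign[of "Inl v"] by (auto simp: \<psi>_def)
    moreover have "\<sigma> (f, w) = \<psi> (Inr f) * \<psi> (Inl w)" if "(f, w) \<in> I" for f w
    proof -
      have "\<sigma> (f, w) = \<phi> (Inr f) * \<phi> (Inl w)" using \<phi> that by (auto simp: potential_def)
      then show ?thesis
        using closed[OF that] s phi_sign[of "Inr e"] phi_sign[of "Inl v"] by (auto simp: \<psi>_def)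
    qed
    ultimately have "potential (insert (e, v) I) \<sigma> \<psi>" by (auto simp: potential_def)
    then show ?thesis by blast
  qed
qed

lemma potential_exists:
  assumes "hypergraph G" "orientation G \<sigma>"
    and "\<And>xs ps. cycle G xs ps \<Longrightarrow> incidence_sign \<sigma> ps > 0"
  shows "\<exists>\<phi>. potential (incidences G) \<sigma> \<phi>"
proof -
  have "\<exists>\<phi>. potential I \<sigma> \<phi>" if "finite I" "I \<subseteq> incidences G" for I
    using that
  proof (induction I rule: finite_induct)
    case empty
    have "potential {} \<sigma> (\<lambda>_. 1)" by (simp add: potential_def)
    then show ?case by blast
  next
    case (insert i I)
    then obtain \<phi> where "potential I \<sigma> \<phi>" by auto
    moreover obtain e v where "i = (e, v)" by fastforce
    ultimately show ?case
      using potential_insert[OF assms(1,2), of e v I \<phi>] assms(3) insert by blast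
  qed
  with finite_incidences(2)[OF assms(1)] show ?thesis by blast
qed

text \<open>On vertices \<open>\<phi>\<close> records the part of the bipartition, on edges which of
  the two sign patterns holds.\<close>

lemma incidence_balanced_iff_potential:
  assumes G: "hypergraph G"
  shows "incidence_balanced G \<sigma> \<longleftrightarrow> (\<exists>\<phi>. potential (incidences G) \<sigma> \<phi>)"
proof
  assume "incidence_balanced G \<sigma>"
  then obtain X Y where XY: "X \<union> Y = verts G" "X \<inter> Y = {}"
    and "\<forall>e\<in>hedges G.
           ((\<forall>v\<in>e \<inter> X. \<sigma> (e, v) = 1) \<and> (\<forall>v\<in>e \<inter> Y. \<sigma> (e, v) = -1)) \<or>
           ((\<forall>v\<in>e \<inter> X. \<sigma> (e, v) = -1) \<and> (\<forall>v\<in>e \<inter> Y. \<sigma> (e, v) = 1))"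
    unfolding incidence_balanced_def by (elim exE conjE)
  then have bal: "((\<forall>v\<in>e \<inter> X. \<sigma> (e, v) = 1) \<and> (\<forall>v\<in>e \<inter> Y. \<sigma> (e, v) = -1)) \<or>
           ((\<forall>v\<in>e \<inter> X. \<sigma> (e, v) = -1) \<and> (\<forall>v\<in>e \<inter> Y. \<sigma> (e, v) = 1))" if "e \<in> hedges G" for e
    using that by blast
  \<comment> \<open>Only the empty edge satisfies both patterns. It has no incidences, so its
    default value 1 is harmless.\<close>
  define \<phi> :: "'a + 'a set \<Rightarrow> int" where "\<phi> = case_sum (\<lambda>v. if v \<in> X then 1 else -1)
    (\<lambda>e. if (\<forall>v\<in>e \<inter> X. \<sigma> (e, v) = 1) \<and> (\<forall>v\<in>e \<inter> Y. \<sigma> (e, v) = -1) then 1 else -1)"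
  have "\<sigma> (e, v) = \<phi> (Inr e) * \<phi> (Inl v)" if "(e, v) \<in> incidences G" for e v
  proof -
    have e: "e \<in> hedges G" and v: "v \<in> e" using that by (auto simp: incidences_def)
    with G XY have "v \<in> X \<longleftrightarrow> v \<notin> Y" by (auto simp: hypergraph_def)
    then show ?thesis using bal[OF e] v by (auto simp: \<phi>_def)
  qed
  moreover have "\<phi> x \<in> {-1, 1}" for x by (cases x) (auto simp: \<phi>_def)
  ultimately show "\<exists>\<phi>. potential (incidences G) \<sigma> \<phi>" unfolding potential_def by blast
next
  assume "\<exists>\<phi>. potential (incidences G) \<sigma> \<phi>"
  then obtain \<phi> where pot: "potential (incidences G) \<sigma> \<phi>" ..
  then have phi_sign: "\<phi> x = -1 \<or> \<phi> x = 1" for x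
    by (auto simp: potential_def)
  from pot have \<phi>: "\<sigma> (e, v) = \<phi> (Inr e) * \<phi> (Inl v)" if "e \<in> hedges G" "v \<in> e" for e v
    using that by (auto simp: potential_def incidences_def)
  define X where "X = {v \<in> verts G. \<phi> (Inl v) = 1}"
  define Y where "Y = {v \<in> verts G. \<phi> (Inl v) = -1}"
  have "v \<in> X \<union> Y" if "v \<in> verts G" for v
    using phi_sign[of "Inl v"] that by (auto simp: X_def Y_def)
  then have "X \<union> Y = verts G" "X \<inter> Y = {}"
    by (auto simp: X_def Y_def)
  moreover have "((\<forall>v\<in>e \<inter> X. \<sigma> (e, v) = 1) \<and> (\<forall>v\<in>e \<inter> Y. \<sigma> (e, v) = -1)) \<or>
           ((\<forall>v\<in>e \<inter> X. \<sigma> (e, v) = -1) \<and> (\<forall>v\<in>e \<inter> Y. \<sigma> (e, v) = 1))" if "e \<in> hedges G" for e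
    using phi_sign[of "Inr e"] by (elim disjE) (simp_all add: \<phi>[OF that] X_def Y_def)
  ultimately show "incidence_balanced G \<sigma>"
    unfolding incidence_balanced_def by (intro exI conjI ballI)
qed


section \<open>Switching\<close>

text \<open>Closed form for switching once at every element of \<open>A\<close>, in any order; an
  incidence with both ends in \<open>A\<close> is negated twice.\<close>

definition switch_set ::
    "'v hypergraph \<Rightarrow> ('v + 'v set) set \<Rightarrow> ('v incidence \<Rightarrow> int) \<Rightarrow> 'v incidence \<Rightarrow> int" where
  "switch_set G A \<sigma> = (\<lambda>(e, v)\<in>incidences G.
     (if Inr e \<in> A then -1 else 1) * (if Inl v \<in> A then -1 else 1) * \<sigma> (e, v))"

lemma switching_step_switch_set_insert:
  assumes "x \<in> elements G" "x \<notin> A"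
  shows "switching_step G (switch_set G A \<sigma>) (switch_set G (insert x A) \<sigma>)"
proof (cases x)
  case (Inl w)
  then have "switch_set G (insert x A) \<sigma> = switch_vertex G w (switch_set G A \<sigma>)"
    using assms by (auto simp: switch_set_def switch_vertex_def restrict_def fun_eq_iff)
  with Inl assms show ?thesis by (auto simp: switching_step_def elements_def)
next
  case (Inr f)
  then have "switch_set G (insert x A) \<sigma> = switch_edge G f (switch_set G A \<sigma>)"
    using assms by (auto simp: switch_set_def switch_edge_def restrict_def fun_eq_iff)
  with Inr assms show ?thesis by (auto simp: switching_step_def elements_def)
qed

lemma switching_equivalent_switch_set:
  assumes "orientation G \<sigma>" "finite A" "A \<subseteq> elements G"
  shows "switching_equivalent G \<sigma> (switch_set G A \<sigma>)"
  using assms(2,3)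
proof (induction A rule: finite_induct)
  case empty
  \<comment> \<open>\<open>switch_set\<close> restricts to the incidences, which changes nothing
    because orientations are extensional.\<close>
  have "switch_set G {} \<sigma> = \<sigma>"
    using assms(1) by (auto simp: switch_set_def orientation_def fun_eq_iff PiE_iff extensional_def)
  then show ?case by (simp add: switching_equivalent_def)
next
  case (insert x A)
  then show ?case
    using switching_step_switch_set_insert[of x G A \<sigma>]
    by (auto simp: switching_equivalent_def intro: rtranclp.rtrancl_into_rtrancl)
qed

text \<open>The potential is carried backwards, from the result \<open>\<tau>\<close> to
  \<open>\<sigma>\<close>, since the constant potential is known at the end of the switching
  sequence, on \<open>positive_orientation G\<close>.\<close>

lemma potential_switching_step:
  assumes "switching_step G \<sigma> \<tau>" "potential (incidences G) \<tau> \<phi>"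
  shows "\<exists>\<psi>. potential (incidences G) \<sigma> \<psi>"
proof -
  have neg: "(\<phi>(x := - \<phi> x)) y \<in> {-1, 1}" for x y
    using assms(2) by (auto simp: potential_def)
  have \<tau>: "\<tau> (e, v) = \<phi> (Inr e) * \<phi> (Inl v)" if "(e, v) \<in> incidences G" for e v
    using assms(2) that by (auto simp: potential_def)
  from assms(1) consider w where "\<tau> = switch_vertex G w \<sigma>" | f where "\<tau> = switch_edge G f \<sigma>"
    by (auto simp: switching_step_def)
  then show ?thesis
  proof cases
    case 1
    have "\<sigma> (e, v) = (\<phi>(Inl w := - \<phi> (Inl w))) (Inr e) * (\<phi>(Inl w := - \<phi> (Inl w))) (Inl v)"
      if "(e, v) \<in> incidences G" for e v
      using \<tau>[OF that] that by (auto simp: 1 switch_vertex_def split: if_splits)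
    with neg show ?thesis unfolding potential_def by blast
  next
    case 2
    have "\<sigma> (e, v) = (\<phi>(Inr f := - \<phi> (Inr f))) (Inr e) * (\<phi>(Inr f := - \<phi> (Inr f))) (Inl v)"
      if "(e, v) \<in> incidences G" for e v
      using \<tau>[OF that] that by (auto simp: 2 switch_edge_def split: if_splits)
    with neg show ?thesis unfolding potential_def by blast
  qed
qed

lemma switching_equivalent_positive_iff_potential:
  assumes G: "hypergraph G" and \<sigma>: "orientation G \<sigma>"
  shows "switching_equivalent G \<sigma> (positive_orientation G) \<longleftrightarrow>
           (\<exists>\<phi>. potential (incidences G) \<sigma> \<phi>)"
proof
  assume "switching_equivalent G \<sigma> (positive_orientation G)"
  then show "\<exists>\<phi>. potential (incidences G) \<sigma> \<phi>"
    unfolding switching_equivalent_def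
  proof (induction rule: converse_rtranclp_induct)
    case base
    have "potential (incidences G) (positive_orientation G) (\<lambda>_. 1)"
      by (simp add: potential_def positive_orientation_def)
    then show ?case by blast
  next
    case (step \<sigma> \<tau>)
    then show ?case using potential_switching_step by blast
  qed
next
  assume "\<exists>\<phi>. potential (incidences G) \<sigma> \<phi>"
  then obtain \<phi> where \<phi>: "potential (incidences G) \<sigma> \<phi>" ..
  \<comment> \<open>Switching at the elements of value -1 multiplies \<open>\<sigma> (e, v)\<close>
    by \<open>\<phi> (Inr e) * \<phi> (Inl v)\<close>, which turns it into a square.\<close>
  define A where "A = {x \<in> elements G. \<phi> x = -1}"
  have "switch_set G A \<sigma> (e, v) = 1" if "(e, v) \<in> incidences G" for e v
  proof -
    have "\<phi> x = -1 \<or> \<phi> x = 1" for x using \<phi> by (auto simp: potential_def)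
    note phi_sign = this[of "Inr e"] this[of "Inl v"]
    have "\<sigma> (e, v) = \<phi> (Inr e) * \<phi> (Inl v)" using \<phi> that by (auto simp: potential_def)
    with phi_sign show ?thesis
      using that incidence_in_elements[OF G that]
      by (auto simp: switch_set_def A_def)
  qed
  then have "switch_set G A \<sigma> = positive_orientation G"
    by (auto simp: positive_orientation_def switch_set_def fun_eq_iff)
  moreover have "finite A" "A \<subseteq> elements G"
    using finite_elements[OF G] by (auto simp: A_def)
  ultimately show "switching_equivalent G \<sigma> (positive_orientation G)"
    using switching_equivalent_switch_set[OF \<sigma>] by metis
qed

theorem theorem2p2:
  fixes G :: "'v hypergraph" and \<sigma> :: "'v incidence \<Rightarrow> int"
  assumes "hypergraph G" and "orientation G \<sigma>"
  shows
    "(incidence_balanced G \<sigma> \<longleftrightarrow>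
        (\<forall>xs ps. cycle G xs ps \<longrightarrow> incidence_sign \<sigma> ps > 0)) \<and>
     ((\<forall>xs ps. cycle G xs ps \<longrightarrow> incidence_sign \<sigma> ps > 0) \<longleftrightarrow>
        (\<forall>a\<in>elements G. \<forall>b\<in>elements G. \<forall>xs ps ys qs.
           path_between G a b xs ps \<and> path_between G a b ys qs \<longrightarrow>
           incidence_sign \<sigma> ps = incidence_sign \<sigma> qs)) \<and>
     ((\<forall>a\<in>elements G. \<forall>b\<in>elements G. \<forall>xs ps ys qs.
           path_between G a b xs ps \<and> path_between G a b ys qs \<longrightarrow>
           incidence_sign \<sigma> ps = incidence_sign \<sigma> qs) \<longleftrightarrow>
        balanced (signed_incidence_graph G \<sigma>)) \<and>
     (balanced (signed_incidence_graph G \<sigma>) \<longleftrightarrow>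
        switching_equivalent G \<sigma> (positive_orientation G))"
proof -
  let ?pot = "\<exists>\<phi>. potential (incidences G) \<sigma> \<phi>"
  let ?cycles = "\<forall>xs ps. cycle G xs ps \<longrightarrow> incidence_sign \<sigma> ps > 0"
  let ?paths = "\<forall>a\<in>elements G. \<forall>b\<in>elements G. \<forall>xs ps ys qs.
           path_between G a b xs ps \<and> path_between G a b ys qs \<longrightarrow>
           incidence_sign \<sigma> ps = incidence_sign \<sigma> qs"
  \<comment> \<open>Potential, path signs and cycle signs imply one another in a circle; the other
    three conditions are tied to a potential or to cycle signs by the lemmas above.\<close>
  have paths: ?paths if ?pot
  proof -
    from that obtain \<phi> where \<phi>: "potential (incidences G) \<sigma> \<phi>" ..
    have "incidence_sign \<sigma> ps = \<phi> a * \<phi> b" if "path_between G a b xs ps" for a b xs ps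
      using that walk_sign_potential[OF _ \<phi>, of G xs ps]
      by (auto simp: path_between_def path_def walk_def)
    then show ?thesis by metis
  qed
  have cycles: ?cycles if ?paths
    using cycle_positive_if_path_signs_agree[OF assms(2)] that by blast
  have pot: ?pot if ?cycles
    using potential_exists[OF assms] that by blast
  have "?cycles \<longleftrightarrow> ?pot" and "?paths \<longleftrightarrow> ?pot"
    using paths cycles pot by argo+
  then show ?thesis
    unfolding incidence_balanced_iff_potential[OF assms(1)] balanced_signed_incidence_graph_iff
      switching_equivalent_positive_iff_potential[OF assms]
    by argo
qed

end
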